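(* Let $H_1,H_2$ be real Hilbert spaces, $C:H_1\to H_2$ a bounded linear mapping with adjoint $C^T:H_2\to H_1$, and $\mathcal{M}_1:H_1\rightrightarrows H_1$, $\mathcal{M}_2:H_2\rightrightarrows H_2$ maximal monotone operators. Let $\lambda>0$ and $y\in H_1$ be given. Choose $\kappa>0$ such that $\frac{\lambda}{\kappa}\in(0,2/\|C\|^2)$, and let the sequence $(\alpha_k)\subset(0,1)$ be such that $\sum_{k=1}^\infty\alpha_k(1-\alpha_k)=\infty$. Construct the sequence $(u_k)$ as follows (Algorithm 3): $$u_0\in H_2,\qquad u_{k+1}=(1-\alpha_k)u_k+\alpha_k\mathcal{P}(u_k),\qquad k=0,1,2,\ldots,$$ where $$\mathcal{P}(u):=(\mathcal{M}_2)_\kappa\Big(C J_{\lambda\mathcal{M}_1}(y-\lambda C^Tu)+\kappa u\Big).$$ Then the sequence $(u_k)$ converges weakly to a fixed point $u$ of $\mathcal{P}$. In addition, if $\inf\alpha_k>0$, then $J_{\lambda\mathcal{M}_1}(y-\lambda C^Tu_k)\to J_{\lambda(\mathcal{M}_1+C^T\mathcal{M}_2C)}(y)$ strongly.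
   Context: The composite $C^T\mathcal{M}_2C:H_1\rightrightarrows H_1$ is $C^T\mathcal{M}_2C(x)=\{C^Tu^*: u^*\in\mathcal{M}_2(Cx)\}$, and sums of set-valued operators are pointwise. The resolvent of an operator $\mathcal{A}$ is $J_{\mathcal{A}}=(I+\mathcal{A})^{-1}$, so $x=J_{\lambda(\mathcal{M}_1+C^T\mathcal{M}_2C)}(y)$ means that $x\in H_1$ satisfies $y\in x+\lambda\mathcal{M}_1x+\lambda C^T\mathcal{M}_2Cx$. The Yosida approximation of $\mathcal{M}_2$ of index $\kappa>0$ is $(\mathcal{M}_2)_\kappa=\frac1\kappa(I-J_{\kappa\mathcal{M}_2})=(\kappa I+\mathcal{M}_2^{-1})^{-1}$.
   Formalization: It is additionally assumed that J_{λ(M_1+C^T M_2 C)}(y) exists, i.e. y ∈ x+λM_1x+λC^T M_2Cx has a solution x; this holds exactly when P has a fixed point, and without it the claim fails (e.g. C=I on R, M_1, M_2 normal cones of {0}, {1}). *)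

theory Defs
  imports "HOL-Analysis.Analysis"
begin

type_synonym ('a, 'b) setop = "'a \<Rightarrow> 'b set"

definition monotone_op :: "('a::real_inner, 'a) setop \<Rightarrow> bool" where
  "monotone_op A \<longleftrightarrow> (\<forall>x y. \<forall>u\<in>A x. \<forall>v\<in>A y. 0 \<le> (x - y) \<bullet> (u - v))"

definition maximal_monotone :: "('a::real_inner, 'a) setop \<Rightarrow> bool" where
  "maximal_monotone A \<longleftrightarrow>
     monotone_op A \<and> (\<forall>B. monotone_op B \<and> (\<forall>x. A x \<subseteq> B x) \<longrightarrow> B = A)"

definition op_plus :: "('a, 'b::real_vector) setop \<Rightarrow> ('a, 'b) setop \<Rightarrow> ('a, 'b) setop" where
  "op_plus A B x = {u + v |u v. u \<in> A x \<and> v \<in> B x}"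

definition op_scale :: "real \<Rightarrow> ('a, 'b::real_vector) setop \<Rightarrow> ('a, 'b) setop" where
  "op_scale c A x = (\<lambda>u. c *\<^sub>R u) ` A x"

definition op_inverse :: "('a, 'b) setop \<Rightarrow> ('b, 'a) setop" where
  "op_inverse A y = {x. y \<in> A x}"

definition op_id :: "('a, 'a) setop" where
  "op_id x = {x}"

definition op_composite ::
  "('a::real_inner \<Rightarrow> 'b::real_inner) \<Rightarrow> ('b, 'b) setop \<Rightarrow> ('a, 'a) setop" where
  "op_composite C M x = adjoint C ` M (C x)"

definition resolvent_set :: "('a::real_vector, 'a) setop \<Rightarrow> ('a, 'a) setop" where
  "resolvent_set A = op_inverse (op_plus op_id A)"

text \<open>The resolvent as a function. This is meaningful only at points where the set-valued
  resolvent is nonempty; for a monotone operator its value is then a singleton, by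
  \<open>resolvent_eqI\<close> below.\<close>

definition resolvent :: "('a::real_vector, 'a) setop \<Rightarrow> 'a \<Rightarrow> 'a" where
  "resolvent A y = (THE x. x \<in> resolvent_set A y)"

definition yosida :: "real \<Rightarrow> ('a::real_vector, 'a) setop \<Rightarrow> 'a \<Rightarrow> 'a" where
  "yosida kap M z = (1 / kap) *\<^sub>R (z - resolvent (op_scale kap M) z)"

definition P_map ::
  "('a::real_inner \<Rightarrow> 'b::real_inner) \<Rightarrow> ('a, 'a) setop \<Rightarrow> ('b, 'b) setop \<Rightarrow>
   real \<Rightarrow> real \<Rightarrow> 'a \<Rightarrow> 'b \<Rightarrow> 'b" where
  "P_map C M1 M2 lam kap y u =
     yosida kap M2 (C (resolvent (op_scale lam M1) (y - lam *\<^sub>R adjoint C u)) + kap *\<^sub>R u)"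

definition weakly_converges :: "(nat \<Rightarrow> 'a::real_normed_vector) \<Rightarrow> 'a \<Rightarrow> bool" where
  "weakly_converges u l \<longleftrightarrow>
     (\<forall>f :: 'a \<Rightarrow> real. bounded_linear f \<longrightarrow> (\<lambda>k. f (u k)) \<longlonglongrightarrow> f l)"

lemma mem_resolvent_set_iff: "x \<in> resolvent_set A y \<longleftrightarrow> (\<exists>a\<in>A x. y = x + a)"
  by (auto simp: resolvent_set_def op_inverse_def op_plus_def op_id_def)

lemma resolvent_eqI:
  assumes mono: "monotone_op A" and x: "x \<in> resolvent_set A y"
  shows "resolvent A y = x"
  unfolding resolvent_def
proof (rule the_equality)
  fix x' assume "x' \<in> resolvent_set A y"
  then obtain a' where a': "a' \<in> A x'" "y = x' + a'"
    by (auto simp: mem_resolvent_set_iff)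
  from x obtain a where a: "a \<in> A x" "y = x + a"
    by (auto simp: mem_resolvent_set_iff)
  have "a' - a = - (x' - x)"
    using a(2) a'(2) by (simp add: algebra_simps)
  moreover have "0 \<le> (x' - x) \<bullet> (a' - a)"
    using mono a(1) a'(1) by (auto simp: monotone_op_def)
  ultimately have "(x' - x) \<bullet> (x' - x) \<le> 0"
    by (metis inner_minus_right neg_0_le_iff_le)
  then show "x' = x"
    by (metis eq_iff_diff_eq_0 inner_ge_zero inner_eq_zero_iff order_antisym)
qed (rule x)

end

theory Submission
  imports Defs
begin

text \<open>Write \<open>J v\<close> for the resolvent of \<open>lam M1\<close> at \<open>y - lam C\<^sup>T v\<close>, so that \<open>P v\<close> is the Yosida
  approximation of \<open>M2\<close> at \<open>C (J v) + kap v\<close>. A point \<open>v\<close> is fixed by \<open>P\<close> exactly when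
  \<open>v \<in> M2 (C (J v))\<close>. Hence the solution \<open>x\<close> of \<open>y \<in> x + lam M1 x + lam C\<^sup>T M2 (C x)\<close> provides
  a fixed point, namely the element of \<open>M2 (C x)\<close> that witnesses the inclusion, and \<open>J\<close> maps
  that fixed point back to \<open>x\<close> (\<open>fixed_point_of_resolvent\<close>).

  The iteration is the Krasnoselskii-Mann iteration of \<open>P\<close>. Firm nonexpansiveness of the
  resolvent and the Lipschitz constant \<open>1 / kap\<close> of the Yosida approximation combine to
  \<open>(norm (P v - P v'))\<^sup>2 \<le> (norm (v - v'))\<^sup>2 - \<delta> * (norm (J v - J v'))\<^sup>2\<close>, and the restriction
  on \<open>lam / kap\<close> says precisely that \<open>\<delta> > 0\<close> (\<open>P_map_contraction\<close>). So \<open>P\<close> is nonexpansive, and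
  \<open>Krasnoselskii_Mann_weak_convergence\<close> gives the weak limit. The term with \<open>\<delta>\<close> gives the strong
  convergence: at each step the squared distance to a fixed point drops by at least
  \<open>\<alpha> k * \<delta>\<close> times the squared error of \<open>J (u k)\<close>, and these drops tend to 0.

  The resolvents are defined everywhere by Minty's theorem, and the adjoint exists by Riesz
  representation. Both follow from one elementary fact about minimising \<open>c \<bullet> c + s\<close> over a
  convex set of pairs \<open>(c, s)\<close> (\<open>quadratic_infimum_variational\<close>); weak cluster points of bounded
  sequences come from Tychonoff's theorem and Riesz representation.\<close>

section \<open>Minimising a quadratic functional over a convex set\<close>

text \<open>The functional \<open>c \<bullet> c + s\<close> is uniformly convex in \<open>c\<close>, so the first components of a
  minimising sequence form a Cauchy sequence even when \<open>K\<close> is neither closed nor bounded; the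
  infimum \<open>m \<ge> m0\<close> need not be attained. The first-order optimality condition survives in the
  limit \<open>x\<close>, where the second components tend to \<open>m - x \<bullet> x\<close>. It is this inequality that
  solves the Riesz problem and Minty's problem below.\<close>

lemma quadratic_infimum_variational:
  fixes K :: "('a::{real_inner, complete_space} \<times> real) set"
  assumes "convex K"
    and bound: "\<And>c s. (c, s) \<in> K \<Longrightarrow> m0 \<le> c \<bullet> c + s"
  shows "\<exists>x. \<forall>(c, s)\<in>K. x \<bullet> x + m0 \<le> 2 * (x \<bullet> c) + s"
proof (cases "K = {}")
  case True
  then show ?thesis by simp
next
  case False
  define E where "E = (\<lambda>(c::'a, s::real). c \<bullet> c + s)"
  define m where "m = Inf (E ` K)"
  have bdd: "bdd_below (E ` K)"
    using bound by (intro bdd_belowI[of _ m0]) (auto simp: E_def)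
  have m_le: "m \<le> c \<bullet> c + s" if "(c, s) \<in> K" for c s
    using cINF_lower[OF bdd that] by (simp add: m_def E_def)
  have m0_le: "m0 \<le> m"
    unfolding m_def using False bound by (intro cInf_greatest) (auto simp: E_def)
  have "\<exists>q\<in>K. E q < m + inverse (real (Suc n))" for n
    using cInf_lessD[of "E ` K" "m + inverse (real (Suc n))"] False by (auto simp: m_def)
  then obtain q where q: "\<And>n. q n \<in> K" "\<And>n. E (q n) < m + inverse (real (Suc n))"
    by metis
  define c where "c n = fst (q n)" for n
  define s where "s n = snd (q n)" for n
  have cs: "(c n, s n) \<in> K" for n
    using q(1) by (simp add: c_def s_def)
  have cs_lt: "c n \<bullet> c n + s n < m + inverse (real (Suc n))" for n
    using q(2)[of n] by (simp add: c_def s_def E_def case_prod_beta)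
  have E_lim: "(\<lambda>n. c n \<bullet> c n + s n) \<longlonglongrightarrow> m"
  proof (rule real_tendsto_sandwich[OF _ _ tendsto_const])
    show "(\<lambda>n. m + inverse (real (Suc n))) \<longlonglongrightarrow> m"
      using LIMSEQ_inverse_real_of_nat_add by blast
  qed (use m_le[OF cs] less_imp_le[OF cs_lt] in auto)
  \<comment> \<open>The parallelogram law at the midpoint of two near-minimisers bounds their distance.\<close>
  have near: "(norm (c i - c j))\<^sup>2 \<le> 4 * inverse (real (Suc N))" if "N \<le> i" "N \<le> j" for N i j
  proof -
    define e where "e = inverse (real (Suc N))"
    have "(1/2) *\<^sub>R (c i, s i) + (1/2) *\<^sub>R (c j, s j) \<in> K"
      using \<open>convex K\<close> cs by (intro convexD) auto
    then have "m \<le> (1/4) * ((c i + c j) \<bullet> (c i + c j)) + (s i + s j) / 2"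
      using m_le[of "(1/2) *\<^sub>R c i + (1/2) *\<^sub>R c j" "(s i + s j) / 2"]
      by (simp add: inner_add_left inner_add_right algebra_simps add_divide_distrib)
    then have "4 * m \<le> c i \<bullet> c i + 2 * (c i \<bullet> c j) + c j \<bullet> c j + 2 * (s i + s j)"
      by (simp add: inner_add_left inner_add_right inner_commute field_simps)
    moreover have "inverse (real (Suc i)) \<le> inverse (real (Suc N))"
      "inverse (real (Suc j)) \<le> inverse (real (Suc N))"
      using that by (auto simp: divide_simps)
    then have "c i \<bullet> c i + s i \<le> m + e" "c j \<bullet> c j + s j \<le> m + e"
      using cs_lt[of i] cs_lt[of j] unfolding e_def by linarith+
    moreover have "(norm (c i - c j))\<^sup>2 = c i \<bullet> c i - 2 * (c i \<bullet> c j) + c j \<bullet> c j"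
      by (simp add: power2_norm_eq_inner inner_diff_left inner_diff_right inner_commute)
    ultimately show ?thesis unfolding e_def[symmetric] by argo
  qed
  have "Cauchy c"
  proof (rule metric_CauchyI)
    fix e :: real assume "e > 0"
    then obtain N where N: "inverse (real (Suc N)) < e\<^sup>2 / 4"
      using reals_Archimedean[of "e\<^sup>2 / 4"] by auto
    have "dist (c i) (c j) < e" if "N \<le> i" "N \<le> j" for i j
    proof -
      have "(norm (c i - c j))\<^sup>2 < e\<^sup>2"
        using near[OF that] N by linarith
      then show ?thesis
        using \<open>e > 0\<close> by (simp add: dist_norm power_less_imp_less_base)
    qed
    then show "\<exists>N. \<forall>i\<ge>N. \<forall>j\<ge>N. dist (c i) (c j) < e" by blast
  qed
  then obtain x where x: "c \<longlonglongrightarrow> x"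
    using Cauchy_convergent convergent_def by blast
  have s_lim: "s \<longlonglongrightarrow> m - x \<bullet> x"
    using tendsto_diff[OF E_lim tendsto_inner[OF x x]] by simp
  have "x \<bullet> x + m \<le> 2 * (x \<bullet> d) + r" if dr: "(d, r) \<in> K" for d r
  proof -
    \<comment> \<open>The derivative of the functional at the limit point in the direction of \<open>d\<close>
      is nonnegative; it is obtained from difference quotients along the minimising sequence.\<close>
    have slope: "0 \<le> 2 * (x \<bullet> (d - x)) + t * ((d - x) \<bullet> (d - x)) + (r - (m - x \<bullet> x))"
      if t: "0 < t" "t < 1" for t
    proof -
      have "m \<le> (c n + t *\<^sub>R (d - c n)) \<bullet> (c n + t *\<^sub>R (d - c n)) + (s n + t * (r - s n))" for n
      proof -
        have "(1 - t) *\<^sub>R (c n, s n) + t *\<^sub>R (d, r) \<in> K"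
          using \<open>convex K\<close> cs dr t by (intro convexD) auto
        then have "(c n + t *\<^sub>R (d - c n), s n + t * (r - s n)) \<in> K"
          by (simp add: algebra_simps)
        then show ?thesis by (rule m_le)
      qed
      moreover have "(\<lambda>n. (c n + t *\<^sub>R (d - c n)) \<bullet> (c n + t *\<^sub>R (d - c n)) + (s n + t * (r - s n)))
        \<longlonglongrightarrow> (x + t *\<^sub>R (d - x)) \<bullet> (x + t *\<^sub>R (d - x)) + ((m - x \<bullet> x) + t * (r - (m - x \<bullet> x)))"
        by (intro tendsto_intros x s_lim)
      ultimately have "m \<le> (x + t *\<^sub>R (d - x)) \<bullet> (x + t *\<^sub>R (d - x))
          + ((m - x \<bullet> x) + t * (r - (m - x \<bullet> x)))"
        using LIMSEQ_le_const by blast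
      then have "0 \<le> t * (2 * (x \<bullet> (d - x)) + t * ((d - x) \<bullet> (d - x)) + (r - (m - x \<bullet> x)))"
        by (simp add: inner_add_left inner_add_right inner_diff_left inner_diff_right
            inner_commute algebra_simps)
      then show ?thesis using t by (simp add: zero_le_mult_iff)
    qed
    have "((\<lambda>t. 2 * (x \<bullet> (d - x)) + t * ((d - x) \<bullet> (d - x)) + (r - (m - x \<bullet> x)))
        \<longlongrightarrow> 2 * (x \<bullet> (d - x)) + 0 * ((d - x) \<bullet> (d - x)) + (r - (m - x \<bullet> x))) (at_right 0)"
      by (intro tendsto_intros)
    moreover have "\<forall>\<^sub>F t in at_right (0::real). 0 < t \<and> t < 1"
      by (auto simp: eventually_at_right_field intro!: exI[of _ 1])
    ultimately have "0 \<le> 2 * (x \<bullet> (d - x)) + 0 * ((d - x) \<bullet> (d - x)) + (r - (m - x \<bullet> x))"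
      by (intro tendsto_lowerbound) (auto elim!: eventually_mono intro: slope)
    then show ?thesis by (simp add: inner_diff_right algebra_simps)
  qed
  then show ?thesis using m0_le by (intro exI[of _ x]) fastforce
qed

text \<open>Minimise \<open>c \<bullet> c - f c\<close>. The optimality condition bounds the linear functional
  \<open>2 * (x \<bullet> c) - f c\<close> of \<open>c\<close> from below, so that functional vanishes.\<close>

lemma Riesz_representation:
  fixes f :: "'a::{real_inner, complete_space} \<Rightarrow> real"
  assumes "bounded_linear f"
  shows "\<exists>v. \<forall>x. f x = x \<bullet> v"
proof -
  interpret bounded_linear f by fact
  obtain B where B: "\<And>x. norm (f x) \<le> norm x * B" using bounded by blast
  define K where "K = range (\<lambda>c. (c, - f c))"
  have "convex K"
    unfolding convex_def K_def by (auto simp: image_iff add scaleR)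
  moreover have "- B\<^sup>2 / 4 \<le> c \<bullet> c + s" if "(c, s) \<in> K" for c s
  proof -
    have "0 \<le> (norm c - B / 2)\<^sup>2" by simp
    then have "- B\<^sup>2 / 4 \<le> (norm c)\<^sup>2 - norm c * B"
      by (simp add: power2_eq_square field_simps)
    also have "\<dots> \<le> c \<bullet> c + s"
      using B[of c] that by (auto simp: K_def power2_norm_eq_inner)
    finally show ?thesis .
  qed
  ultimately obtain x where x: "\<And>c. x \<bullet> x + - B\<^sup>2 / 4 \<le> 2 * (x \<bullet> c) - f c"
    using quadratic_infimum_variational[of K "- B\<^sup>2 / 4"] by (auto simp: K_def)
  have "f c = c \<bullet> (2 *\<^sub>R x)" for c
  proof (rule ccontr)
    define g where "g = 2 * (x \<bullet> c) - f c"
    define L where "L = x \<bullet> x + - B\<^sup>2 / 4"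
    assume "f c \<noteq> c \<bullet> (2 *\<^sub>R x)"
    then have "g \<noteq> 0" by (simp add: g_def inner_commute)
    have "L \<le> t * g" for t
      using x[of "t *\<^sub>R c"] by (simp add: g_def L_def scaleR algebra_simps)
    from this[of "(L - 1) / g"] show False using \<open>g \<noteq> 0\<close> by simp
  qed
  then show ?thesis by blast
qed

text \<open>The adjoint is a choice term; Riesz representation of \<open>x \<mapsto> C x \<bullet> v\<close> supplies a witness.\<close>

lemma inner_adjoint:
  fixes C :: "'a::{real_inner, complete_space} \<Rightarrow> 'b::real_inner"
  assumes "bounded_linear C"
  shows "x \<bullet> adjoint C v = C x \<bullet> v"
proof -
  have "\<exists>w. \<forall>x. C x \<bullet> v = x \<bullet> w" for v
    using bounded_linear_compose[OF bounded_linear_inner_left assms]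
    by (intro Riesz_representation)
  then have "\<exists>C'. \<forall>x v. C x \<bullet> v = x \<bullet> C' v" by metis
  then have "\<forall>x v. C x \<bullet> v = x \<bullet> adjoint C v"
    unfolding adjoint_def by (rule someI_ex)
  then show ?thesis by simp
qed

section \<open>Minty's theorem\<close>

text \<open>The inequality is quadratic, but its polarisation \<open>a \<bullet> b' + a' \<bullet> b \<le> s + s'\<close> is affine in
  each of the two triples separately, and for two graph points it is just monotonicity. It
  therefore extends to the hull in one argument at a time, and the diagonal is the claim.\<close>

lemma convex_hull_monotone_graph:
  fixes G :: "('a::real_inner \<times> 'a) set"
  assumes mono: "\<And>a b a' b'. (a, b) \<in> G \<Longrightarrow> (a', b') \<in> G \<Longrightarrow> 0 \<le> (a - a') \<bullet> (b - b')"
    and hull: "(a, b, s) \<in> convex hull ((\<lambda>(a, b). (a, b, a \<bullet> b)) ` G)"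
  shows "a \<bullet> b \<le> s"
proof -
  let ?T = "(\<lambda>(a, b). (a, b, a \<bullet> b)) ` G"
  define Q :: "'a \<times> 'a \<times> real \<Rightarrow> 'a \<times> 'a \<times> real \<Rightarrow> bool"
    where "Q = (\<lambda>(a, b, s) (a', b', s'). a \<bullet> b' + a' \<bullet> b \<le> s + s')"
  have Q_sym: "Q p q = Q q p" for p q
    by (auto simp: Q_def inner_commute add.commute split: prod.splits)
  have Q_convex: "convex {p. Q p q}" for q
  proof (rule convexI)
    fix p p' :: "'a \<times> 'a \<times> real" and t t' :: real
    assume *: "p \<in> {p. Q p q}" "p' \<in> {p. Q p q}" "0 \<le> t" "0 \<le> t'" "t + t' = 1"
    obtain a b s a' b' s' c d r where p: "p = (a, b, s)" "p' = (a', b', s')" "q = (c, d, r)"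
      by (metis prod.exhaust)
    have "t * (a \<bullet> d + c \<bullet> b) + t' * (a' \<bullet> d + c \<bullet> b') \<le> t * (s + r) + t' * (s' + r)"
      using *(1-4) by (intro add_mono[of "t * _" _ "t' * _"] mult_left_mono) (auto simp: Q_def p)
    moreover have "t * r + t' * r = r" using *(5) by (metis distrib_right mult_1)
    ultimately show "t *\<^sub>R p + t' *\<^sub>R p' \<in> {p. Q p q}"
      by (simp add: Q_def p inner_add_left inner_add_right algebra_simps)
  qed
  have "Q p q" if "p \<in> ?T" "q \<in> ?T" for p q
    using that mono
    by (fastforce simp: Q_def inner_diff_left inner_diff_right algebra_simps)
  then have "Q p q" if "p \<in> convex hull ?T" "q \<in> ?T" for p q
    using hull_induct[where Q=convex and P="\<lambda>p. Q p q", OF that(1)] that(2) Q_convex by blast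
  then have "Q p q" if "p \<in> convex hull ?T" "q \<in> convex hull ?T" for p q
    using hull_induct[where Q=convex and P="\<lambda>q. Q q p", OF that(2)] that(1) Q_convex Q_sym by blast
  from this[OF hull hull] show ?thesis by (simp add: Q_def)
qed

text \<open>With \<open>c = (a - b) / 2\<close> and \<open>s = a \<bullet> b\<close> the inequality says \<open>x \<bullet> x \<le> 2 * (x \<bullet> c) + s\<close>,
  that is, \<open>x\<close> lies in the ball with centre \<open>c\<close> and radius \<open>norm (a + b) / 2\<close>. A common point of
  these balls comes from minimising \<open>c \<bullet> c + s\<close> over the convex hull of the pairs \<open>(c, s)\<close>: by
  the previous lemma the functional is at least \<open>((a + b) / 2) \<bullet> ((a + b) / 2) \<ge> 0\<close> there, with
  \<open>a\<close> and \<open>b\<close> now the averaged points.\<close>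

lemma monotone_graph_antidiagonal_point:
  fixes G :: "('a::{real_inner, complete_space} \<times> 'a) set"
  assumes mono: "\<And>a b a' b'. (a, b) \<in> G \<Longrightarrow> (a', b') \<in> G \<Longrightarrow> 0 \<le> (a - a') \<bullet> (b - b')"
  shows "\<exists>x. \<forall>(a, b)\<in>G. 0 \<le> (x - a) \<bullet> (- x - b)"
proof -
  let ?H = "convex hull ((\<lambda>(a, b). (a, b, a \<bullet> b)) ` G)"
  define h :: "'a \<times> 'a \<times> real \<Rightarrow> 'a \<times> real" where "h = (\<lambda>(a, b, s). ((1/2) *\<^sub>R (a - b), s))"
  have "linear h"
    by (auto simp: linear_iff h_def algebra_simps)
  then have "convex (h ` ?H)" by (intro convex_linear_image convex_convex_hull)
  moreover have "0 \<le> c \<bullet> c + s" if cs: "(c, s) \<in> h ` ?H" for c s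
  proof -
    obtain a b where ab: "(a, b, s) \<in> ?H" "c = (1/2) *\<^sub>R (a - b)"
      using cs by (auto simp: h_def)
    have "0 \<le> ((1/2) *\<^sub>R (a + b)) \<bullet> ((1/2) *\<^sub>R (a + b))" by (rule inner_ge_zero)
    also have "\<dots> = c \<bullet> c + a \<bullet> b"
      by (simp add: ab(2) inner_add_left inner_add_right inner_diff_left inner_diff_right
          inner_commute field_simps)
    also have "\<dots> \<le> c \<bullet> c + s"
      using convex_hull_monotone_graph[OF mono ab(1)] by simp
    finally show ?thesis .
  qed
  ultimately obtain x where x: "\<forall>(c, s)\<in>h ` ?H. x \<bullet> x + 0 \<le> 2 * (x \<bullet> c) + s"
    using quadratic_infimum_variational[of "h ` ?H" 0] by blast
  have "0 \<le> (x - a) \<bullet> (- x - b)" if "(a, b) \<in> G" for a b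
  proof -
    have "(a, b, a \<bullet> b) \<in> ?H" using that by (force intro: hull_inc)
    then have "h (a, b, a \<bullet> b) \<in> h ` ?H" by (rule imageI)
    with x have "x \<bullet> x \<le> 2 * (x \<bullet> ((1/2) *\<^sub>R (a - b))) + a \<bullet> b"
      unfolding h_def by fastforce
    then show ?thesis
      by (simp add: inner_diff_left inner_diff_right inner_commute field_simps)
  qed
  then show ?thesis by blast
qed

section \<open>Weak cluster points and weak convergence\<close>

text \<open>If the images under \<open>g\<close> cluster with respect to \<open>F\<close>, then a nontrivial refinement of \<open>G\<close> is mapped
  by \<open>g\<close> below \<open>F\<close>. This turns cluster points into limits along a finer filter.\<close>

lemma inf_filtercomap_neq_bot:
  assumes "inf F (filtermap g G) \<noteq> bot"
  shows "inf (filtercomap g F) G \<noteq> bot"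
proof
  assume "inf (filtercomap g F) G = bot"
  then have "eventually (\<lambda>_. False) (inf (filtercomap g F) G)" by simp
  then obtain P Q where P: "eventually P (filtercomap g F)" and Q: "eventually Q G"
    and PQ: "\<And>k. P k \<Longrightarrow> Q k \<Longrightarrow> False"
    unfolding eventually_inf by blast
  obtain R where R: "eventually R F" "\<And>k. R (g k) \<Longrightarrow> P k"
    using P unfolding eventually_filtercomap by blast
  have "eventually (\<lambda>k. \<not> R (g k)) G"
    using Q by (rule eventually_mono) (use R(2) PQ in blast)
  then have "eventually (\<lambda>z. \<not> R z) (filtermap g G)"
    by (simp add: eventually_filtermap)
  then have "eventually (\<lambda>_. False) (inf F (filtermap g G))"
    unfolding eventually_inf using R(1) by blast
  then show False using assms by (simp add: eventually_False)
qed

text \<open>Represent \<open>u k\<close> by the function \<open>v \<mapsto> u k \<bullet> v\<close>. These functions lie in a product of compact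
  intervals, so by Tychonoff they converge pointwise along a finer filter; the limit inherits
  linearity and the bound, and Riesz representation makes it an element of the space. Working
  with filters avoids both subsequences and separability.\<close>

lemma bounded_weak_cluster_point:
  fixes u :: "'i \<Rightarrow> 'a::{real_inner, complete_space}"
  assumes bounded: "\<And>k. norm (u k) \<le> B" and "F \<noteq> bot"
  shows "\<exists>F' p. F' \<noteq> bot \<and> F' \<le> F \<and> (\<forall>v. ((\<lambda>k. u k \<bullet> v) \<longlongrightarrow> p \<bullet> v) F')"
proof -
  define g where "g = (\<lambda>k (v::'a). u k \<bullet> v)"
  define S where "S = (\<Pi>\<^sub>E v\<in>(UNIV :: 'a set). cball (0::real) (B * norm v))"
  have "compactin (product_topology (\<lambda>v::'a. euclidean :: real topology) UNIV) S"
    unfolding S_def by (subst compactin_PiE) auto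
  then have "compact S" by (simp add: euclidean_product_topology)
  have gS: "g k \<in> S" for k
    using bounded[of k]
    by (auto simp: g_def S_def dist_norm intro!: order_trans[OF Cauchy_Schwarz_ineq2] mult_right_mono)
  then have "eventually (\<lambda>f. f \<in> S) (filtermap g F)"
    by (simp add: eventually_filtermap)
  moreover have "filtermap g F \<noteq> bot"
    using \<open>F \<noteq> bot\<close> by (simp add: filtermap_bot_iff)
  ultimately obtain \<phi> where \<phi>: "\<phi> \<in> S" "inf (nhds \<phi>) (filtermap g F) \<noteq> bot"
    using \<open>compact S\<close> unfolding compact_filter by blast
  define F' where "F' = inf (filtercomap g (nhds \<phi>)) F"
  have "F' \<noteq> bot"
    unfolding F'_def using \<phi>(2) by (rule inf_filtercomap_neq_bot)
  have lim: "((\<lambda>k. u k \<bullet> v) \<longlongrightarrow> \<phi> v) F'" for v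
  proof (rule topological_tendstoI)
    fix U :: "real set" assume U: "open U" "\<phi> v \<in> U"
    have "open ((\<lambda>f. f v) -` U)"
      using U(1) continuous_on_product_coordinates by (rule open_vimage)
    then have "eventually (\<lambda>f. f \<in> (\<lambda>f. f v) -` U) (nhds \<phi>)"
      using U(2) by (intro eventually_nhds_in_open) auto
    then have "eventually (\<lambda>k. g k \<in> (\<lambda>f. f v) -` U) (filtercomap g (nhds \<phi>))"
      by (rule eventually_filtercomapI)
    then show "eventually (\<lambda>k. u k \<bullet> v \<in> U) F'"
      unfolding F'_def by (intro filter_leD[OF inf_le1]) (simp add: g_def)
  qed
  have "bounded_linear \<phi>"
  proof (rule bounded_linear_intro)
    show "\<phi> (v + w) = \<phi> v + \<phi> w" for v w
      using tendsto_add[OF lim[of v] lim[of w]] lim[of "v + w"] \<open>F' \<noteq> bot\<close>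
      by (auto simp: inner_add_right intro: tendsto_unique)
    show "\<phi> (r *\<^sub>R v) = r *\<^sub>R \<phi> v" for r v
      using tendsto_mult_left[OF lim[of v], of r] lim[of "r *\<^sub>R v"] \<open>F' \<noteq> bot\<close>
      by (auto intro: tendsto_unique)
    show "norm (\<phi> v) \<le> norm v * B" for v
      using \<phi>(1) by (auto simp: S_def PiE_iff dist_norm mult.commute)
  qed
  then obtain p where "\<And>v. \<phi> v = p \<bullet> v"
    using Riesz_representation by (metis inner_commute)
  with lim \<open>F' \<noteq> bot\<close> show ?thesis
    by (intro exI[of _ F'] exI[of _ p]) (auto simp: F'_def)
qed

lemma power2_norm_diff:
  fixes a b :: "'a::real_inner"
  shows "(norm (a - b))\<^sup>2 = (norm a)\<^sup>2 - 2 * (a \<bullet> b) + (norm b)\<^sup>2"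
  by (simp add: power2_norm_eq_inner inner_diff_left inner_diff_right inner_commute)

text \<open>Opial's lemma: convergence of the distances to two weak cluster points makes these equal,
  and a bounded sequence with one weak cluster point converges weakly to it.\<close>

lemma Opial_weak_convergence:
  fixes u :: "nat \<Rightarrow> 'a::{real_inner, complete_space}"
  assumes "S \<noteq> {}"
    and dist_conv: "\<And>p. p \<in> S \<Longrightarrow> convergent (\<lambda>k. norm (u k - p))"
    and cluster: "\<And>F p. F \<noteq> bot \<Longrightarrow> F \<le> sequentially \<Longrightarrow>
      (\<And>v. ((\<lambda>k. u k \<bullet> v) \<longlongrightarrow> p \<bullet> v) F) \<Longrightarrow> p \<in> S"
  shows "\<exists>p\<in>S. weakly_converges u p"
proof -
  obtain p0 where "p0 \<in> S" using \<open>S \<noteq> {}\<close> by blast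
  then have "Bseq (\<lambda>k. norm (u k - p0))"
    using dist_conv convergent_imp_Bseq by blast
  then obtain B where B: "\<And>k. norm (u k - p0) \<le> B"
    by (auto simp: Bseq_def)
  have bounded: "norm (u k) \<le> B + norm p0" for k
    using B[of k] norm_triangle_sub[of "u k" p0] by linarith
  \<comment> \<open>Expanding squares, the inner products with \<open>p - q\<close> converge along the whole sequence;
    evaluating the limit along the two filters gives \<open>p \<bullet> (p - q) = q \<bullet> (p - q)\<close>.\<close>
  have unique: "p = q"
    if F: "F \<noteq> bot" "F \<le> sequentially" "\<And>v. ((\<lambda>k. u k \<bullet> v) \<longlongrightarrow> p \<bullet> v) F"
      and G: "G \<noteq> bot" "G \<le> sequentially" "\<And>v. ((\<lambda>k. u k \<bullet> v) \<longlongrightarrow> q \<bullet> v) G"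
    for F G p q
  proof -
    obtain a b where ab: "(\<lambda>k. norm (u k - p)) \<longlonglongrightarrow> a" "(\<lambda>k. norm (u k - q)) \<longlonglongrightarrow> b"
      using dist_conv[OF cluster[OF F]] dist_conv[OF cluster[OF G]] by (auto simp: convergent_def)
    define L where "L = ((norm p)\<^sup>2 - (norm q)\<^sup>2 - (a\<^sup>2 - b\<^sup>2)) / 2"
    have "(\<lambda>k. ((norm p)\<^sup>2 - (norm q)\<^sup>2 - ((norm (u k - p))\<^sup>2 - (norm (u k - q))\<^sup>2)) / 2)
        \<longlonglongrightarrow> L"
      unfolding L_def by (intro tendsto_intros ab) simp
    moreover have "((norm p)\<^sup>2 - (norm q)\<^sup>2 - ((norm (u k - p))\<^sup>2 - (norm (u k - q))\<^sup>2)) / 2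
        = u k \<bullet> (p - q)" for k
      by (simp add: power2_norm_diff inner_diff_right field_simps)
    ultimately have L: "(\<lambda>k. u k \<bullet> (p - q)) \<longlonglongrightarrow> L" by simp
    have "p \<bullet> (p - q) = L"
      using tendsto_unique[OF F(1) F(3) tendsto_mono[OF F(2) L]] .
    moreover have "q \<bullet> (p - q) = L"
      using tendsto_unique[OF G(1) G(3) tendsto_mono[OF G(2) L]] .
    ultimately have "(p - q) \<bullet> (p - q) = 0"
      by (simp add: inner_diff_left)
    then show ?thesis by simp
  qed
  obtain F p where F: "F \<noteq> bot" "F \<le> sequentially" "\<And>v. ((\<lambda>k. u k \<bullet> v) \<longlongrightarrow> p \<bullet> v) F"
    using bounded_weak_cluster_point[where u=u, OF bounded sequentially_bot] by blast
  have lim: "(\<lambda>k. u k \<bullet> v) \<longlonglongrightarrow> p \<bullet> v" for v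
  proof (rule ccontr)
    assume "\<not> ?thesis"
    then obtain e where e: "e > 0" "\<not> (\<forall>\<^sub>F k in sequentially. dist (u k \<bullet> v) (p \<bullet> v) < e)"
      by (auto simp: tendsto_iff)
    define A where "A = {k. \<not> dist (u k \<bullet> v) (p \<bullet> v) < e}"
    have "inf sequentially (principal A) \<noteq> bot"
      using e(2) by (auto simp: A_def trivial_limit_def eventually_inf_principal)
    then obtain G q where G: "G \<noteq> bot" "G \<le> inf sequentially (principal A)"
        "\<And>w. ((\<lambda>k. u k \<bullet> w) \<longlongrightarrow> q \<bullet> w) G"
      using bounded_weak_cluster_point[where u=u, OF bounded] by blast
    then have "p = q" using unique[OF F, of G q] by simp
    then have "\<forall>\<^sub>F k in G. dist (u k \<bullet> v) (p \<bullet> v) < e"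
      using G(3)[of v] e(1) by (auto simp: tendsto_iff)
    moreover have "\<forall>\<^sub>F k in G. k \<in> A"
      using G(2) by (simp add: le_principal)
    ultimately have "\<forall>\<^sub>F k in G. False"
      by eventually_elim (simp add: A_def)
    then show False using G(1) by (simp add: eventually_False)
  qed
  have "weakly_converges u p"
    unfolding weakly_converges_def
  proof (intro allI impI)
    fix f :: "'a \<Rightarrow> real" assume "bounded_linear f"
    then obtain v where "\<And>x. f x = x \<bullet> v" using Riesz_representation by blast
    then show "(\<lambda>k. f (u k)) \<longlonglongrightarrow> f p" using lim[of v] by simp
  qed
  moreover have "p \<in> S" using cluster[OF F] .
  ultimately show ?thesis by blast
qed

text \<open>Weak convergence makes
  \<open>(norm (u k - T p))\<^sup>2 - (norm (u k - p))\<^sup>2\<close> tend to \<open>(norm (p - T p))\<^sup>2\<close>, whereas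
  nonexpansiveness and the vanishing residuals bound this difference by a null sequence.\<close>

lemma nonexpansive_demiclosed:
  fixes T :: "'a::real_inner \<Rightarrow> 'a"
  assumes nonexp: "\<And>x y. norm (T x - T y) \<le> norm (x - y)"
    and bounded: "\<And>k. norm (u k) \<le> B"
    and "F \<noteq> bot"
    and weak: "\<And>v. ((\<lambda>k. u k \<bullet> v) \<longlongrightarrow> p \<bullet> v) F"
    and resid: "((\<lambda>k. norm (u k - T (u k))) \<longlongrightarrow> 0) F"
  shows "T p = p"
proof -
  define r where "r = (\<lambda>k. norm (u k - T (u k)))"
  have upper: "(norm (u k - T p))\<^sup>2 - (norm (u k - p))\<^sup>2 \<le> (r k)\<^sup>2 + 2 * r k * (B + norm p)" for k
  proof -
    have "norm (u k - T p) \<le> r k + norm (T (u k) - T p)"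
      unfolding r_def by (metis norm_triangle_ineq diff_add_cancel add_diff_eq)
    also have "\<dots> \<le> r k + norm (u k - p)" using nonexp by simp
    finally have "(norm (u k - T p))\<^sup>2 \<le> (r k + norm (u k - p))\<^sup>2" by (intro power_mono) auto
    also have "\<dots> = (norm (u k - p))\<^sup>2 + (r k)\<^sup>2 + 2 * r k * norm (u k - p)"
      by (simp add: power2_sum)
    also have "2 * r k * norm (u k - p) \<le> 2 * r k * (B + norm p)"
      using bounded[of k] norm_triangle_ineq4[of "u k" p] by (intro mult_left_mono) (auto simp: r_def)
    finally show ?thesis by simp
  qed
  have expand: "(norm (u k - T p))\<^sup>2 - (norm (u k - p))\<^sup>2
      = 2 * (u k \<bullet> (p - T p)) + (norm (T p))\<^sup>2 - (norm p)\<^sup>2" for k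
    by (simp add: power2_norm_diff inner_diff_right)
  have r: "(r \<longlongrightarrow> 0) F" using resid by (simp add: r_def)
  have "((\<lambda>k. (r k)\<^sup>2 + 2 * r k * (B + norm p)) \<longlongrightarrow> 0\<^sup>2 + 2 * 0 * (B + norm p)) F"
    by (intro tendsto_intros r)
  moreover have "((\<lambda>k. 2 * (u k \<bullet> (p - T p)) + (norm (T p))\<^sup>2 - (norm p)\<^sup>2) \<longlongrightarrow>
      2 * (p \<bullet> (p - T p)) + (norm (T p))\<^sup>2 - (norm p)\<^sup>2) F"
    by (intro tendsto_intros weak)
  ultimately have "2 * (p \<bullet> (p - T p)) + (norm (T p))\<^sup>2 - (norm p)\<^sup>2
      \<le> 0\<^sup>2 + 2 * 0 * (B + norm p)"
    using upper \<open>F \<noteq> bot\<close> unfolding expand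
    by (intro tendsto_le[where F=F]) auto
  moreover have "2 * (p \<bullet> (p - T p)) + (norm (T p))\<^sup>2 - (norm p)\<^sup>2 = (norm (p - T p))\<^sup>2"
    by (simp add: power2_norm_eq_inner inner_diff_left inner_diff_right inner_commute)
  ultimately have "(norm (p - T p))\<^sup>2 \<le> 0" by simp
  then show ?thesis by simp
qed

section \<open>Krasnoselskii-Mann iteration\<close>

lemma power2_norm_convex_combination:
  fixes a b :: "'a::real_inner"
  shows "(norm ((1 - t) *\<^sub>R a + t *\<^sub>R b))\<^sup>2
    = (1 - t) * (norm a)\<^sup>2 + t * (norm b)\<^sup>2 - t * (1 - t) * (norm (a - b))\<^sup>2"
  by (simp add: power2_norm_eq_inner inner_add_left inner_add_right inner_diff_left
      inner_diff_right inner_commute algebra_simps)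

text \<open>The surplus \<open>d\<close> records by how much \<open>T\<close> strictly contracts towards \<open>p\<close>. It is \<open>0\<close> for a
  general nonexpansive map, and for the dual map below it measures the primal error.\<close>

lemma Krasnoselskii_Mann_descent:
  fixes T :: "'a::real_inner \<Rightarrow> 'a"
  assumes "T p = p" and step: "v = (1 - t) *\<^sub>R w + t *\<^sub>R T w"
    and t: "0 \<le> t" and contr: "(norm (T w - p))\<^sup>2 \<le> (norm (w - p))\<^sup>2 - d"
  shows "(norm (v - p))\<^sup>2 \<le> (norm (w - p))\<^sup>2 - t * d - t * (1 - t) * (norm (w - T w))\<^sup>2"
proof -
  have "v - p = (1 - t) *\<^sub>R (w - p) + t *\<^sub>R (T w - p)"
    by (simp add: step algebra_simps)
  then have "(norm (v - p))\<^sup>2 = (1 - t) * (norm (w - p))\<^sup>2 + t * (norm (T w - p))\<^sup>2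
      - t * (1 - t) * (norm (w - T w))\<^sup>2"
    by (simp only: power2_norm_convex_combination) simp
  also have "t * (norm (T w - p))\<^sup>2 \<le> t * ((norm (w - p))\<^sup>2 - d)"
    using contr t by (rule mult_left_mono)
  finally show ?thesis by (simp add: algebra_simps)
qed

text \<open>The descent inequality makes the distances to fixed points decrease, and summing it bounds
  the \<open>\<alpha> k * (1 - \<alpha> k)\<close>-weighted sum of squared residuals. As the weights have infinite sum and
  the residuals decrease, the residuals tend to \<open>0\<close>. By demiclosedness all weak cluster points
  are then fixed, and Opial's lemma applies.\<close>

lemma Krasnoselskii_Mann_weak_convergence:
  fixes T :: "'a::{real_inner, complete_space} \<Rightarrow> 'a"
  assumes nonexp: "\<And>x y. norm (T x - T y) \<le> norm (x - y)"
    and fixed: "T q = q"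
    and \<alpha>: "\<And>k. \<alpha> k \<in> {0 <..< 1}"
    and div: "filterlim (\<lambda>n. \<Sum>k=1..n. \<alpha> k * (1 - \<alpha> k)) at_top sequentially"
    and step: "\<And>k. u (Suc k) = (1 - \<alpha> k) *\<^sub>R u k + \<alpha> k *\<^sub>R T (u k)"
  shows "\<exists>p. T p = p \<and> weakly_converges u p"
proof -
  have \<alpha>_pos: "0 < \<alpha> k" "\<alpha> k < 1" for k using \<alpha>[of k] by auto
  have descent: "(norm (u (Suc k) - p))\<^sup>2
      \<le> (norm (u k - p))\<^sup>2 - \<alpha> k * (1 - \<alpha> k) * (norm (u k - T (u k)))\<^sup>2"
    if "T p = p" for p k
    using Krasnoselskii_Mann_descent[OF that step less_imp_le[OF \<alpha>_pos(1)], of k 0]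
      nonexp[of "u k" p] that by (simp add: power_mono)
  have dist_mono: "norm (u (Suc k) - p) \<le> norm (u k - p)" if "T p = p" for p k
  proof -
    have "0 \<le> \<alpha> k * (1 - \<alpha> k) * (norm (u k - T (u k)))\<^sup>2"
      using \<alpha>_pos[of k] by simp
    then have "(norm (u (Suc k) - p))\<^sup>2 \<le> (norm (u k - p))\<^sup>2"
      using descent[OF that, of k] by linarith
    then show ?thesis by (rule power2_le_imp_le) simp
  qed
  have dist_conv: "convergent (\<lambda>k. norm (u k - p))" if "T p = p" for p
  proof -
    have "decseq (\<lambda>k. norm (u k - p))" using dist_mono[OF that] by (rule decseq_SucI)
    then obtain L where "(\<lambda>k. norm (u k - p)) \<longlonglongrightarrow> L"
      using decseq_convergent[of "\<lambda>k. norm (u k - p)" 0] by auto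
    then show ?thesis by (auto simp: convergent_def)
  qed
  define r where "r = (\<lambda>k. norm (u k - T (u k)))"
  have "r (Suc k) \<le> r k" for k
  proof -
    have "r (Suc k) \<le> norm (u (Suc k) - T (u k)) + norm (T (u k) - T (u (Suc k)))"
      unfolding r_def by (metis norm_triangle_ineq diff_add_cancel add_diff_eq)
    also have "u (Suc k) - T (u k) = (1 - \<alpha> k) *\<^sub>R (u k - T (u k))"
      by (simp add: step algebra_simps)
    also have "norm (T (u k) - T (u (Suc k))) \<le> norm (u k - u (Suc k))" by (rule nonexp)
    also have "u k - u (Suc k) = \<alpha> k *\<^sub>R (u k - T (u k))"
      by (simp add: step algebra_simps)
    finally show ?thesis
      using \<alpha>_pos[of k] by (simp add: r_def flip: distrib_right)
  qed
  then have r_dec: "decseq r" by (rule decseq_SucI)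
  have r_lim: "r \<longlonglongrightarrow> 0"
  proof -
    obtain L where L: "r \<longlonglongrightarrow> L" "\<And>k. L \<le> r k"
      using decseq_convergent[OF r_dec, of 0] by (auto simp: r_def)
    have "L = 0"
    proof (rule ccontr)
      assume "L \<noteq> 0"
      moreover have "0 \<le> L" using L(1) by (rule LIMSEQ_le_const) (auto simp: r_def)
      ultimately have "L > 0" by simp
      \<comment> \<open>The divergent series starts at index 1, so the telescoping starts at \<open>u 1\<close>.\<close>
      have sum_le: "(\<Sum>k=1..n. \<alpha> k * (1 - \<alpha> k)) * L\<^sup>2
          \<le> (norm (u 1 - q))\<^sup>2 - (norm (u (Suc n) - q))\<^sup>2" for n
      proof (induction n)
        case (Suc n)
        have "\<alpha> (Suc n) * (1 - \<alpha> (Suc n)) * L\<^sup>2 \<le> \<alpha> (Suc n) * (1 - \<alpha> (Suc n)) * (r (Suc n))\<^sup>2"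
          using L(2) \<alpha>_pos[of "Suc n"] \<open>L > 0\<close> by (intro mult_left_mono power_mono) auto
        then show ?case
          using Suc descent[OF fixed, of "Suc n"] by (simp add: r_def distrib_right)
      qed simp
      have "(\<Sum>k=1..n. \<alpha> k * (1 - \<alpha> k)) \<le> (norm (u 1 - q))\<^sup>2 / L\<^sup>2" for n
      proof -
        have "(\<Sum>k=1..n. \<alpha> k * (1 - \<alpha> k)) * L\<^sup>2 \<le> (norm (u 1 - q))\<^sup>2"
          using sum_le[of n] zero_le_power2[of "norm (u (Suc n) - q)"] by linarith
        then show ?thesis using \<open>L > 0\<close> by (simp add: pos_le_divide_eq)
      qed
      moreover have "\<forall>\<^sub>F n in sequentially.
          (norm (u 1 - q))\<^sup>2 / L\<^sup>2 + 1 \<le> (\<Sum>k=1..n. \<alpha> k * (1 - \<alpha> k))"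
        using div by (simp add: filterlim_at_top)
      ultimately have "\<forall>\<^sub>F n::nat in sequentially. False"
        by (elim eventually_mono) (smt (verit))
      then show False by simp
    qed
    with L show ?thesis by simp
  qed
  obtain B where B: "\<And>k. norm (u k - q) \<le> B"
    using convergent_imp_Bseq[OF dist_conv[OF fixed]] by (auto simp: Bseq_def)
  have bounded: "norm (u k) \<le> B + norm q" for k
    using B[of k] norm_triangle_sub[of "u k" q] by linarith
  have "\<exists>p\<in>{p. T p = p}. weakly_converges u p"
  proof (rule Opial_weak_convergence)
    fix F p
    assume "F \<noteq> bot" "F \<le> sequentially" "\<And>v. ((\<lambda>k. u k \<bullet> v) \<longlongrightarrow> p \<bullet> v) F"
    moreover have "((\<lambda>k. norm (u k - T (u k))) \<longlongrightarrow> 0) F"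
      using tendsto_mono[OF \<open>F \<le> sequentially\<close> r_lim] by (simp add: r_def)
    ultimately have "T p = p"
      using nonexpansive_demiclosed[where T=T and u=u, OF nonexp bounded] by blast
    then show "p \<in> {p. T p = p}" by simp
  qed (use fixed dist_conv in auto)
  then show ?thesis by blast
qed

lemma maximal_monotone_memI:
  assumes "maximal_monotone M"
    and compat: "\<And>a b. b \<in> M a \<Longrightarrow> 0 \<le> (x - a) \<bullet> (w - b)"
  shows "w \<in> M x"
proof -
  define N where "N = M(x := insert w (M x))"
  have mono: "0 \<le> (a - c) \<bullet> (b - d)" if "b \<in> M a" "d \<in> M c" for a b c d
    using assms(1) that by (auto simp: maximal_monotone_def monotone_op_def)
  have sym: "0 \<le> (a - x) \<bullet> (b - w)" if "b \<in> M a" for a b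
    using compat[OF that] by (metis inner_minus_left inner_minus_right minus_diff_eq minus_minus)
  have "monotone_op N"
    unfolding monotone_op_def N_def using mono compat sym by auto
  moreover have "\<forall>a. M a \<subseteq> N a" by (auto simp: N_def)
  ultimately have "N = M" using assms(1) by (simp add: maximal_monotone_def)
  then show ?thesis by (metis N_def fun_upd_same insertI1)
qed

text \<open>The shifted graph of \<open>lam M - y\<close> reduces the inclusion \<open>y \<in> x + lam M x\<close> to a point
  compatible with a monotone graph on the antidiagonal; maximality turns compatibility into
  membership.\<close>

lemma Minty_surjectivity:
  fixes M :: "('a::{real_inner, complete_space}, 'a) setop"
  assumes M: "maximal_monotone M" and "lam > 0"
  shows "\<exists>x. x \<in> resolvent_set (op_scale lam M) y"
proof -
  define G where "G = {(a, lam *\<^sub>R b - y) | a b. b \<in> M a}"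
  have "0 \<le> (a - a') \<bullet> (b - b')" if "(a, b) \<in> G" "(a', b') \<in> G" for a b a' b'
  proof -
    obtain d d' where d: "d \<in> M a" "d' \<in> M a'" "b = lam *\<^sub>R d - y" "b' = lam *\<^sub>R d' - y"
      using \<open>(a, b) \<in> G\<close> \<open>(a', b') \<in> G\<close> by (auto simp: G_def)
    have "0 \<le> (a - a') \<bullet> (d - d')"
      using M d(1,2) by (auto simp: maximal_monotone_def monotone_op_def)
    moreover have "(a - a') \<bullet> (b - b') = lam * ((a - a') \<bullet> (d - d'))"
      by (simp add: d inner_diff_right algebra_simps)
    ultimately show ?thesis using \<open>lam > 0\<close> by simp
  qed
  then obtain x where x: "\<forall>(a, b)\<in>G. 0 \<le> (x - a) \<bullet> (- x - b)"
    using monotone_graph_antidiagonal_point by blast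
  have "(1 / lam) *\<^sub>R (y - x) \<in> M x"
  proof (rule maximal_monotone_memI[OF M])
    fix a b assume "b \<in> M a"
    then have "(a, lam *\<^sub>R b - y) \<in> G" by (auto simp: G_def)
    with x have "0 \<le> (x - a) \<bullet> (- x - (lam *\<^sub>R b - y))" by blast
    moreover have "- x - (lam *\<^sub>R b - y) = lam *\<^sub>R ((1 / lam) *\<^sub>R (y - x) - b)"
      using \<open>lam > 0\<close> by (simp add: algebra_simps)
    ultimately show "0 \<le> (x - a) \<bullet> ((1 / lam) *\<^sub>R (y - x) - b)"
      using \<open>lam > 0\<close> by (simp add: zero_le_mult_iff)
  qed
  then have "y - x \<in> op_scale lam M x"
    using \<open>lam > 0\<close> unfolding op_scale_def by (auto intro!: image_eqI[rotated])
  then show ?thesis by (auto simp: mem_resolvent_set_iff intro!: bexI[rotated])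
qed

section \<open>Resolvents and Yosida approximations\<close>

lemma monotone_op_scale:
  assumes "monotone_op M" "0 \<le> c"
  shows "monotone_op (op_scale c M)"
  using assms by (auto simp: monotone_op_def op_scale_def simp flip: scaleR_diff_right)

text \<open>Minty's theorem is what makes the resolvent, a definite description, meaningful at every
  point, so that the equivalence needs no domain condition.\<close>

lemma resolvent_scale_iff:
  fixes M :: "('a::{real_inner, complete_space}, 'a) setop"
  assumes "maximal_monotone M" and "lam > 0"
  shows "resolvent (op_scale lam M) z = x \<longleftrightarrow> (1 / lam) *\<^sub>R (z - x) \<in> M x"
proof -
  have mono: "monotone_op (op_scale lam M)"
    using assms by (simp add: monotone_op_scale maximal_monotone_def)
  have "resolvent (op_scale lam M) z = x \<longleftrightarrow> x \<in> resolvent_set (op_scale lam M) z"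
    using Minty_surjectivity[OF assms, of z] resolvent_eqI[OF mono] by blast
  also have "\<dots> \<longleftrightarrow> (\<exists>w\<in>M x. z - x = lam *\<^sub>R w)"
    by (auto simp: mem_resolvent_set_iff op_scale_def algebra_simps)
  also have "\<dots> \<longleftrightarrow> (1 / lam) *\<^sub>R (z - x) \<in> M x"
  proof
    assume "(1 / lam) *\<^sub>R (z - x) \<in> M x"
    then show "\<exists>w\<in>M x. z - x = lam *\<^sub>R w"
      using \<open>lam > 0\<close> by (intro bexI[of _ "(1 / lam) *\<^sub>R (z - x)"]) auto
  qed (use \<open>lam > 0\<close> in auto)
  finally show ?thesis .
qed

lemma resolvent_firmly_nonexpansive:
  fixes M :: "('a::{real_inner, complete_space}, 'a) setop"
  assumes M: "maximal_monotone M" and "lam > 0"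
  defines "J \<equiv> resolvent (op_scale lam M)"
  shows "(norm (J z - J z'))\<^sup>2 \<le> (J z - J z') \<bullet> (z - z')"
proof -
  have "(1 / lam) *\<^sub>R (z - J z) \<in> M (J z)" "(1 / lam) *\<^sub>R (z' - J z') \<in> M (J z')"
    unfolding J_def using iffD1[OF resolvent_scale_iff[OF M \<open>lam > 0\<close>] refl] by blast+
  then have "0 \<le> (J z - J z') \<bullet> ((1 / lam) *\<^sub>R (z - J z) - (1 / lam) *\<^sub>R (z' - J z'))"
    using M unfolding maximal_monotone_def monotone_op_def by blast
  then have "0 \<le> (J z - J z') \<bullet> ((z - J z) - (z' - J z'))"
    using \<open>lam > 0\<close> by (simp add: zero_le_divide_iff flip: scaleR_diff_right)
  then show ?thesis
    by (simp add: power2_norm_eq_inner inner_diff_left inner_diff_right inner_commute)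
qed

text \<open>Stated pointwise, this says that the Yosida approximation is the inverse of \<open>kap I\<close> plus the
  inverse of \<open>M\<close>.\<close>

lemma yosida_eq_iff:
  fixes M :: "('a::{real_inner, complete_space}, 'a) setop"
  assumes "maximal_monotone M" and "kap > 0"
  shows "yosida kap M z = w \<longleftrightarrow> w \<in> M (z - kap *\<^sub>R w)"
proof -
  have "yosida kap M z = w \<longleftrightarrow> resolvent (op_scale kap M) z = z - kap *\<^sub>R w"
  proof -
    have "(1 / kap) *\<^sub>R d = w \<longleftrightarrow> d = kap *\<^sub>R w" for d
      using \<open>kap > 0\<close> by auto
    then have "yosida kap M z = w \<longleftrightarrow> z - resolvent (op_scale kap M) z = kap *\<^sub>R w"
      unfolding yosida_def .
    then show ?thesis by (auto simp: diff_eq_eq eq_diff_eq add.commute)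
  qed
  also have "\<dots> \<longleftrightarrow> w \<in> M (z - kap *\<^sub>R w)"
    using \<open>kap > 0\<close> by (simp add: resolvent_scale_iff[OF assms])
  finally show ?thesis .
qed

lemma yosida_lipschitz:
  fixes M :: "('a::{real_inner, complete_space}, 'a) setop"
  assumes M: "maximal_monotone M" and "kap > 0"
  shows "kap * norm (yosida kap M z - yosida kap M z') \<le> norm (z - z')"
proof -
  define w w' where "w = yosida kap M z" and "w' = yosida kap M z'"
  have "w \<in> M (z - kap *\<^sub>R w)" "w' \<in> M (z' - kap *\<^sub>R w')"
    unfolding w_def w'_def using iffD1[OF yosida_eq_iff[OF M \<open>kap > 0\<close>] refl] by blast+
  then have "0 \<le> ((z - kap *\<^sub>R w) - (z' - kap *\<^sub>R w')) \<bullet> (w - w')"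
    using M unfolding maximal_monotone_def monotone_op_def by blast
  also have "\<dots> = (z - z') \<bullet> (w - w') - kap * (norm (w - w'))\<^sup>2"
    by (simp add: power2_norm_eq_inner inner_diff_left inner_diff_right inner_commute algebra_simps)
  also have "\<dots> \<le> norm (z - z') * norm (w - w') - kap * (norm (w - w'))\<^sup>2"
    using norm_cauchy_schwarz[of "z - z'" "w - w'"] by simp
  finally have "kap * norm (w - w') * norm (w - w') \<le> norm (z - z') * norm (w - w')"
    by (simp add: power2_eq_square)
  then show ?thesis
    by (cases "w = w'") (auto simp: w_def w'_def)
qed

section \<open>The dual fixed point map\<close>

lemma P_map_fixed_point_iff:
  fixes C :: "'a::{real_inner, complete_space} \<Rightarrow> 'b::{real_inner, complete_space}"
  assumes "maximal_monotone M2" and "kap > 0"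
  shows "P_map C M1 M2 lam kap y v = v \<longleftrightarrow>
    v \<in> M2 (C (resolvent (op_scale lam M1) (y - lam *\<^sub>R adjoint C v)))"
  by (simp add: P_map_def yosida_eq_iff[OF assms])

text \<open>Put \<open>dx = J v - J v'\<close> and \<open>dv = v - v'\<close>. Since the argument of the resolvent contains
  \<open>- lam\<close> times the adjoint, firm nonexpansiveness makes \<open>C dx \<bullet> dv\<close> at most
  \<open>- (norm dx)\<^sup>2 / lam\<close>. In the expansion of \<open>(norm (C dx + kap dv))\<^sup>2\<close> this cross term, weighted
  with \<open>2 kap\<close>, outweighs \<open>(norm (C dx))\<^sup>2\<close> when \<open>lam / kap < 2 / (onorm C)\<^sup>2\<close>.\<close>

lemma P_map_contraction:
  fixes C :: "'a::{real_inner, complete_space} \<Rightarrow> 'b::{real_inner, complete_space}"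
    and lam y
  assumes C: "bounded_linear C"
    and M1: "maximal_monotone M1" and M2: "maximal_monotone M2"
    and "lam > 0" "kap > 0"
  defines "J \<equiv> \<lambda>v. resolvent (op_scale lam M1) (y - lam *\<^sub>R adjoint C v)"
    and "P \<equiv> P_map C M1 M2 lam kap y"
  shows "(norm (P v - P v'))\<^sup>2 \<le> (norm (v - v'))\<^sup>2
    - (2 * kap / lam - (onorm C)\<^sup>2) / kap\<^sup>2 * (norm (J v - J v'))\<^sup>2"
proof -
  interpret C: bounded_linear C by fact
  define dx where "dx = J v - J v'"
  define dv where "dv = v - v'"
  have "(norm dx)\<^sup>2 \<le> dx \<bullet> ((y - lam *\<^sub>R adjoint C v) - (y - lam *\<^sub>R adjoint C v'))"
    unfolding dx_def J_def by (rule resolvent_firmly_nonexpansive[OF M1 \<open>lam > 0\<close>])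
  also have "\<dots> = - lam * (C dx \<bullet> dv)"
    by (simp add: dv_def inner_diff_right inner_adjoint[OF C] algebra_simps)
  finally have cross: "C dx \<bullet> dv \<le> - (norm dx)\<^sup>2 / lam"
    using \<open>lam > 0\<close> by (simp add: field_simps)
  have Cdx: "(norm (C dx))\<^sup>2 \<le> (onorm C)\<^sup>2 * (norm dx)\<^sup>2"
    using onorm[OF C, of dx] by (simp add: power_mono flip: power_mult_distrib)
  have "kap * norm (P v - P v') \<le> norm ((C (J v) + kap *\<^sub>R v) - (C (J v') + kap *\<^sub>R v'))"
    unfolding P_def P_map_def J_def by (rule yosida_lipschitz[OF M2 \<open>kap > 0\<close>])
  also have "(C (J v) + kap *\<^sub>R v) - (C (J v') + kap *\<^sub>R v') = C dx + kap *\<^sub>R dv"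
    by (simp add: dx_def dv_def C.diff algebra_simps)
  finally have "(kap * norm (P v - P v'))\<^sup>2 \<le> (norm (C dx + kap *\<^sub>R dv))\<^sup>2"
    using \<open>kap > 0\<close> by (intro power_mono) auto
  also have "\<dots> = (norm (C dx))\<^sup>2 + 2 * kap * (C dx \<bullet> dv) + kap\<^sup>2 * (norm dv)\<^sup>2"
    by (simp add: power2_norm_eq_inner inner_add_left inner_add_right inner_commute
        power2_eq_square[of kap])
  also have "\<dots> \<le> (onorm C)\<^sup>2 * (norm dx)\<^sup>2 + 2 * kap * (- (norm dx)\<^sup>2 / lam)
      + kap\<^sup>2 * (norm dv)\<^sup>2"
    using cross Cdx \<open>kap > 0\<close> by (intro add_mono mult_left_mono) auto
  finally show ?thesis
    using \<open>kap > 0\<close> \<open>lam > 0\<close>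
    unfolding dx_def[symmetric] dv_def[symmetric] by (simp add: field_simps power_mult_distrib)
qed

lemma monotone_op_plus_composite:
  fixes C :: "'a::{real_inner, complete_space} \<Rightarrow> 'b::real_inner"
  assumes C: "bounded_linear C" and "monotone_op M1" "monotone_op M2"
  shows "monotone_op (op_plus M1 (op_composite C M2))"
proof -
  interpret C: bounded_linear C by fact
  have "0 \<le> (x - x') \<bullet> ((a + adjoint C w) - (a' + adjoint C w'))"
    if "a \<in> M1 x" "a' \<in> M1 x'" "w \<in> M2 (C x)" "w' \<in> M2 (C x')" for x x' a a' w w'
  proof -
    have "0 \<le> (x - x') \<bullet> (a - a')" "0 \<le> (C x - C x') \<bullet> (w - w')"
      using assms that by (auto simp: monotone_op_def)
    moreover have "(x - x') \<bullet> ((a + adjoint C w) - (a' + adjoint C w'))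
        = (x - x') \<bullet> (a - a') + (C x - C x') \<bullet> (w - w')"
      by (simp add: inner_diff_right inner_add_right inner_adjoint[OF C] C.diff)
    ultimately show ?thesis by linarith
  qed
  then show ?thesis
    by (auto simp: monotone_op_def op_plus_def op_composite_def)
qed

text \<open>Primal solutions yield dual ones: the element \<open>v\<close> of \<open>M2 (C x)\<close> that witnesses the inclusion
  for \<open>x\<close> is a fixed point, and the inner resolvent recovers \<open>x\<close> from it.\<close>

lemma fixed_point_of_resolvent:
  fixes C :: "'a::{real_inner, complete_space} \<Rightarrow> 'b::{real_inner, complete_space}"
  assumes C: "bounded_linear C"
    and M1: "maximal_monotone M1" and M2: "maximal_monotone M2"
    and "lam > 0" "kap > 0"
    and x: "x \<in> resolvent_set (op_scale lam (op_plus M1 (op_composite C M2))) y"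
  shows "\<exists>v. P_map C M1 M2 lam kap y v = v \<and>
    resolvent (op_scale lam M1) (y - lam *\<^sub>R adjoint C v) = x"
proof -
  obtain a v where av: "a \<in> M1 x" "v \<in> M2 (C x)" "y = x + lam *\<^sub>R (a + adjoint C v)"
    using x by (auto simp: mem_resolvent_set_iff op_scale_def op_plus_def op_composite_def)
  have "(1 / lam) *\<^sub>R (y - lam *\<^sub>R adjoint C v - x) = a"
    using \<open>lam > 0\<close> by (simp add: av(3) algebra_simps)
  then have "resolvent (op_scale lam M1) (y - lam *\<^sub>R adjoint C v) = x"
    using av(1) by (simp add: resolvent_scale_iff[OF M1 \<open>lam > 0\<close>])
  moreover from this have "P_map C M1 M2 lam kap y v = v"
    using av(2) by (simp add: P_map_fixed_point_iff[OF M2 \<open>kap > 0\<close>])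
  ultimately show ?thesis by blast
qed

theorem theorem11:
  fixes C :: "'a::{real_inner, complete_space} \<Rightarrow> 'b::{real_inner, complete_space}"
    and M1 :: "('a, 'a) setop"
    and M2 :: "('b, 'b) setop"
    and lam kap :: real
    and y :: 'a
    and \<alpha> :: "nat \<Rightarrow> real"
    and u :: "nat \<Rightarrow> 'b"
  assumes "bounded_linear C"
    and "maximal_monotone M1"
    and "maximal_monotone M2"
    and "lam > 0"
    (* J_{lambda (M1 + C^T M2 C)}(y) is defined; otherwise P has no fixed point *)
    and "resolvent_set (op_scale lam (op_plus M1 (op_composite C M2))) y \<noteq> {}"
    and "kap > 0"
    (* in ereal, so that the upper bound is infinite for C = 0 *)
    and "ereal (lam / kap) \<in> {0 <..< 2 / ereal ((onorm C)\<^sup>2)}"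
    and "\<And>k. \<alpha> k \<in> {0 <..< 1}"
    and "filterlim (\<lambda>n. \<Sum>k=1..n. \<alpha> k * (1 - \<alpha> k)) at_top sequentially"
    and "\<And>k. u (Suc k) = (1 - \<alpha> k) *\<^sub>R u k + \<alpha> k *\<^sub>R P_map C M1 M2 lam kap y (u k)"
  shows "(\<exists>u_fix. P_map C M1 M2 lam kap y u_fix = u_fix \<and> weakly_converges u u_fix) \<and>
    ((INF k. \<alpha> k) > 0 \<longrightarrow>
      (\<lambda>k. resolvent (op_scale lam M1) (y - lam *\<^sub>R adjoint C (u k)))
        \<longlonglongrightarrow> resolvent (op_scale lam (op_plus M1 (op_composite C M2))) y)"
proof -
  note C = assms(1) and M1 = assms(2) and M2 = assms(3)
  define P where "P = P_map C M1 M2 lam kap y"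
  define J where "J = (\<lambda>v. resolvent (op_scale lam M1) (y - lam *\<^sub>R adjoint C v))"
  define x where "x = resolvent (op_scale lam (op_plus M1 (op_composite C M2))) y"
  define \<delta> where "\<delta> = (2 * kap / lam - (onorm C)\<^sup>2) / kap\<^sup>2"
  have step: "u (Suc k) = (1 - \<alpha> k) *\<^sub>R u k + \<alpha> k *\<^sub>R P (u k)" for k
    using assms(10) by (simp add: P_def)
  have \<alpha>_pos: "0 < \<alpha> k" "\<alpha> k < 1" for k using assms(8)[of k] by auto
  \<comment> \<open>For \<open>C = 0\<close> the upper bound on \<open>lam / kap\<close> is infinite and gives no real inequality.\<close>
  have "(onorm C)\<^sup>2 < 2 * kap / lam"
  proof (cases "onorm C = 0")
    case True
    then show ?thesis using \<open>lam > 0\<close> \<open>kap > 0\<close> by simp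
  next
    case False
    then have "lam / kap < 2 / (onorm C)\<^sup>2" using assms(7) by (simp add: numeral_eq_ereal)
    then show ?thesis using False \<open>lam > 0\<close> \<open>kap > 0\<close> by (simp add: field_simps)
  qed
  then have "\<delta> > 0" using \<open>kap > 0\<close> by (simp add: \<delta>_def)
  have contraction: "(norm (P v - P v'))\<^sup>2 \<le> (norm (v - v'))\<^sup>2 - \<delta> * (norm (J v - J v'))\<^sup>2" for v v'
    unfolding P_def J_def \<delta>_def by (rule P_map_contraction[OF C M1 M2 \<open>lam > 0\<close> \<open>kap > 0\<close>])
  have nonexp: "norm (P v - P v') \<le> norm (v - v')" for v v'
  proof -
    have "0 \<le> \<delta> * (norm (J v - J v'))\<^sup>2" using \<open>\<delta> > 0\<close> by simp
    then have "(norm (P v - P v'))\<^sup>2 \<le> (norm (v - v'))\<^sup>2" using contraction[of v v'] by linarith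
    then show ?thesis by (rule power2_le_imp_le) simp
  qed
  have "monotone_op (op_scale lam (op_plus M1 (op_composite C M2)))"
    using M1 M2 \<open>lam > 0\<close>
    by (simp add: monotone_op_scale monotone_op_plus_composite[OF C] maximal_monotone_def)
  then have "x \<in> resolvent_set (op_scale lam (op_plus M1 (op_composite C M2))) y"
    using assms(5) resolvent_eqI unfolding x_def by (metis all_not_in_conv)
  then obtain q where q: "P q = q" "J q = x"
    using fixed_point_of_resolvent[OF C M1 M2 \<open>lam > 0\<close> \<open>kap > 0\<close>] unfolding P_def J_def by blast
  have "\<exists>p. P p = p \<and> weakly_converges u p"
    using Krasnoselskii_Mann_weak_convergence[OF nonexp q(1) assms(8,9) step] .
  \<comment> \<open>Relaxation parameters bounded away from 0 let the decrease of the squared distance to \<open>q\<close>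
    control the primal error, and that decrease tends to 0.\<close>
  moreover have "(\<lambda>k. J (u k)) \<longlonglongrightarrow> x" if inf: "(INF k. \<alpha> k) > 0"
  proof -
    define c where "c = (INF k. \<alpha> k)"
    have c: "c \<le> \<alpha> k" for k
      unfolding c_def using \<alpha>_pos(1)
      by (intro cINF_lower) (auto intro!: bdd_belowI[of _ 0] less_imp_le)
    define D where "D k = (norm (u k - q))\<^sup>2" for k
    have descent: "c * \<delta> * (norm (J (u k) - x))\<^sup>2 \<le> D k - D (Suc k)" for k
    proof -
      have "(norm (P (u k) - q))\<^sup>2 \<le> (norm (u k - q))\<^sup>2 - \<delta> * (norm (J (u k) - x))\<^sup>2"
        using contraction[of "u k" q] by (simp add: q)
      then have "D (Suc k) \<le> D k - \<alpha> k * (\<delta> * (norm (J (u k) - x))\<^sup>2)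
          - \<alpha> k * (1 - \<alpha> k) * (norm (u k - P (u k)))\<^sup>2"
        unfolding D_def
        by (rule Krasnoselskii_Mann_descent[OF q(1) step less_imp_le[OF \<alpha>_pos(1)]])
      moreover have "0 \<le> \<alpha> k * (1 - \<alpha> k) * (norm (u k - P (u k)))\<^sup>2"
        using \<alpha>_pos[of k] by simp
      moreover have "c * (\<delta> * (norm (J (u k) - x))\<^sup>2) \<le> \<alpha> k * (\<delta> * (norm (J (u k) - x))\<^sup>2)"
        using c \<open>\<delta> > 0\<close> by (intro mult_right_mono) auto
      ultimately show ?thesis by (simp add: mult.assoc)
    qed
    have "c * \<delta> > 0" using inf \<open>\<delta> > 0\<close> by (simp add: c_def)
    have "D (Suc k) \<le> D k" for k
    proof -
      have "0 \<le> c * \<delta> * (norm (J (u k) - x))\<^sup>2"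
        by (rule mult_nonneg_nonneg[OF less_imp_le[OF \<open>c * \<delta> > 0\<close>]]) simp
      then show ?thesis using descent[of k] by linarith
    qed
    then have "decseq D" by (rule decseq_SucI)
    then obtain L where L: "D \<longlonglongrightarrow> L"
      using decseq_convergent[of D 0] by (auto simp: D_def)
    have "(\<lambda>k. (D k - D (Suc k)) / (c * \<delta>)) \<longlonglongrightarrow> (L - L) / (c * \<delta>)"
      by (intro tendsto_intros L LIMSEQ_Suc) (use \<open>c * \<delta> > 0\<close> in auto)
    then have drops: "(\<lambda>k. (D k - D (Suc k)) / (c * \<delta>)) \<longlonglongrightarrow> 0" by simp
    have "(norm (J (u k) - x))\<^sup>2 \<le> (D k - D (Suc k)) / (c * \<delta>)" for k
      using descent[of k] \<open>c * \<delta> > 0\<close> by (simp only: pos_le_divide_eq mult.commute)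
    then have "(\<lambda>k. (norm (J (u k) - x))\<^sup>2) \<longlonglongrightarrow> 0"
      by (intro real_tendsto_sandwich[OF _ _ tendsto_const drops] always_eventually) auto
    then have "(\<lambda>k. norm (J (u k) - x)) \<longlonglongrightarrow> 0"
      using tendsto_real_sqrt[of "\<lambda>k. (norm (J (u k) - x))\<^sup>2" 0] by simp
    then show ?thesis by (simp add: tendsto_norm_zero_iff LIM_zero_iff)
  qed
  ultimately show ?thesis by (simp add: P_def J_def x_def)
qed

end
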